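(* Let $0<c\le 1$ and let $M_n$ be a $c$-maximally ST-robust DAG with $n$ inputs and $n$ outputs. Then $\mathbb{O}(M_n)$ is maximally ST-robust, i.e. it is $(k,n-k)$-ST-robust for all $0\le k\le n$.
   Context: For a DAG $M$ with a set $I$ of $n$ inputs and a set $O$ of $n$ outputs, $M$ is $(k_1,k_2)$-ST-robust if for every $D\subseteq V(M)$ with $|D|\le k_1$ there is a subgraph $H$ of $M-D$ with $|I\cap V(H)|\ge k_2$, $|O\cap V(H)|\ge k_2$, such that every $s\in I\cap V(H)$ has a directed path in $H$ to every $t\in O\cap V(H)$. $M$ is $c$-maximally ST-robust if it is $(k,n-k)$-ST-robust for all $0\le k\le cn$. Construction $\mathbb{O}(M_n)$: take new input nodes $i_1,\dots,i_n$ and new output nodes $o_1,\dots,o_n$, and $\lceil 1/c\rceil$ disjoint copies $S_1,\dots,S_{\lceil 1/c\rceil}$ of $M_n$, where $S_j$ has inputs $i_1^j,\dots,i_n^j$ and outputs $o_1^j,\dots,o_n^j$. For every $1\le j\le\lceil 1/c\rceil$ and $1\le k\le n$ add edges $(i_k,i_k^j)$ and $(o_k^j,o_k)$. The inputs of $\mathbb{O}(M_n)$ are $i_1,\dots,i_n$ and its outputs are $o_1,\dots,o_n$. *)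

theory Defs
  imports Complex_Main "Graph_Theory.Graph_Theory"
begin

text \<open>
  The inputs and outputs are enumerated by \<open>inp\<close> and \<open>outp\<close> on the indices \<open>1, \<dots>, n\<close>; the values of
  these functions at other indices are irrelevant.  The input set is \<open>inp ` {1..n}\<close> and the output
  set is \<open>outp ` {1..n}\<close>.
\<close>

locale io_dag = pair_fin_digraph M
  for M :: "'a pair_pre_digraph" +
  fixes n :: nat and inp outp :: "nat \<Rightarrow> 'a"
  assumes acyclic_arcs: "acyclic (parcs M)"
    and inj_inp: "inj_on inp {1..n}" and inp_verts: "inp ` {1..n} \<subseteq> pverts M"
    and inj_outp: "inj_on outp {1..n}" and outp_verts: "outp ` {1..n} \<subseteq> pverts M"

definition ST_robust ::
  "'a pair_pre_digraph \<Rightarrow> 'a set \<Rightarrow> 'a set \<Rightarrow> nat \<Rightarrow> nat \<Rightarrow> bool" where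
  "ST_robust M Ins Outs k1 k2 \<longleftrightarrow>
     (\<forall>D \<subseteq> pverts M. card D \<le> k1 \<longrightarrow>
       (\<exists>H. subgraph H (with_proj M \<restriction> (pverts M - D)) \<and>
            card (Ins \<inter> verts H) \<ge> k2 \<and> card (Outs \<inter> verts H) \<ge> k2 \<and>
            (\<forall>s \<in> Ins \<inter> verts H. \<forall>t \<in> Outs \<inter> verts H. \<exists>p. pre_digraph.apath H s p t)))"

definition c_maximally_ST_robust ::
  "real \<Rightarrow> 'a pair_pre_digraph \<Rightarrow> nat \<Rightarrow> (nat \<Rightarrow> 'a) \<Rightarrow> (nat \<Rightarrow> 'a) \<Rightarrow> bool" where
  "c_maximally_ST_robust c M n inp outp \<longleftrightarrow>
     (\<forall>k::nat. real k \<le> c * real n \<longrightarrow> ST_robust M (inp ` {1..n}) (outp ` {1..n}) k (n - k))"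

definition maximally_ST_robust ::
  "'a pair_pre_digraph \<Rightarrow> nat \<Rightarrow> (nat \<Rightarrow> 'a) \<Rightarrow> (nat \<Rightarrow> 'a) \<Rightarrow> bool" where
  "maximally_ST_robust M n inp outp \<longleftrightarrow>
     (\<forall>k \<le> n. ST_robust M (inp ` {1..n}) (outp ` {1..n}) k (n - k))"

text \<open>\<open>Copy j v\<close> is the vertex \<open>v\<close> in the \<open>j\<close>-th copy \<open>S\<^sub>j\<close>.\<close>

datatype 'a O_vertex = New_In nat | New_Out nat | Copy nat 'a

definition num_copies :: "real \<Rightarrow> nat" where
  "num_copies c = nat \<lceil>1 / c\<rceil>"

definition O_graph ::
  "real \<Rightarrow> 'a pair_pre_digraph \<Rightarrow> nat \<Rightarrow> (nat \<Rightarrow> 'a) \<Rightarrow> (nat \<Rightarrow> 'a) \<Rightarrow> 'a O_vertex pair_pre_digraph" where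
  "O_graph c M n inp outp =
    \<lparr> pverts = New_In ` {1..n} \<union> New_Out ` {1..n} \<union>
        {Copy j v | j v. j \<in> {1..num_copies c} \<and> v \<in> pverts M},
      parcs = {(Copy j u, Copy j v) | j u v. j \<in> {1..num_copies c} \<and> (u, v) \<in> parcs M} \<union>
        {(New_In k, Copy j (inp k)) | j k. j \<in> {1..num_copies c} \<and> k \<in> {1..n}} \<union>
        {(Copy j (outp k), New_Out k) | j k. j \<in> {1..num_copies c} \<and> k \<in> {1..n}} \<rparr>"

lemma io_dag_O_graph:
  assumes "io_dag M n inp outp"
  shows "io_dag (O_graph c M n inp outp) n New_In New_Out"
proof -
  interpret io_dag M n inp outp by fact
  let ?G = "O_graph c M n inp outp"
  let ?J = "{1..num_copies c}"
  have V: "finite (pverts ?G)"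
  proof -
    have "{Copy j v | j v. j \<in> ?J \<and> v \<in> pverts M} = (\<lambda>(j, v). Copy j v) ` (?J \<times> pverts M)"
      by auto
    then show ?thesis by (simp add: O_graph_def pair_finite_verts)
  qed
  have sub: "parcs ?G \<subseteq> pverts ?G \<times> pverts ?G"
    using inp_verts outp_verts by (auto simp: O_graph_def image_subset_iff dest: in_arcsD1 in_arcsD2)
  then have A: "finite (parcs ?G)"
    using V by (meson finite_SigmaI finite_subset)
  define f :: "'a O_vertex \<Rightarrow> nat \<times> 'a" where
    "f x = (case x of New_In k \<Rightarrow> (0, undefined) | Copy j v \<Rightarrow> (1, v) | New_Out k \<Rightarrow> (2, undefined))"
    for x
  have "wf (parcs M)"
    by (rule finite_acyclic_wf) (use pair_finite_arcs acyclic_arcs in auto)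
  then have "wf (inv_image (less_than <*lex*> parcs M) f)"
    by (intro wf_inv_image wf_lex_prod wf_less_than)
  moreover have "parcs ?G \<subseteq> inv_image (less_than <*lex*> parcs M) f"
    by (auto simp: O_graph_def f_def)
  ultimately have "acyclic (parcs ?G)"
    by (meson wf_acyclic wf_subset)
  moreover have "New_In ` {1..n} \<subseteq> pverts ?G" "New_Out ` {1..n} \<subseteq> pverts ?G"
    by (auto simp: O_graph_def)
  ultimately show ?thesis
    using V A sub by unfold_locales (auto simp: inj_on_def)
qed

end

theory Submission
  imports Defs
begin

text \<open>
  If \<open>k \<le> n\<close> vertices are deleted, then by the pigeonhole principle one of the \<open>m = \<lceil>1/c\<rceil>\<close> copies
  loses some number \<open>k'\<close> of them with \<open>k' \<le> n/m \<le> cn\<close>.  Robustness of \<open>M\<close> provides a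
  subgraph of that copy connecting \<open>n - k'\<close> inputs to \<open>n - k'\<close> outputs.  Extend it by the surviving
  new inputs and outputs attached to it: the vertices deleted among the new inputs (or outputs) are
  disjoint from those deleted in the copy, so at least \<open>n - k\<close> of them are left.
\<close>

text \<open>A map that sends vertices to vertices and arcs to arcs sends walks to walks. It serves
  to carry the paths that robustness of \<open>M\<close> yields into one copy of
  \<open>M\<close>.\<close>

lemma reachable_map:
  assumes "s \<rightarrow>\<^sup>*\<^bsub>G\<^esub> t" and "wf_digraph H"
    and "\<And>v. v \<in> verts G \<Longrightarrow> f v \<in> verts H"
    and "\<And>u v. u \<rightarrow>\<^bsub>G\<^esub> v \<Longrightarrow> f u \<rightarrow>\<^bsub>H\<^esub> f v"
  shows "f s \<rightarrow>\<^sup>*\<^bsub>H\<^esub> f t"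
proof -
  interpret H: wf_digraph H by fact
  from assms(1) show ?thesis unfolding reachable_def
  proof (induction rule: rtrancl_on_induct)
    case base
    then show ?case using assms(3) by (simp flip: reachable_def)
  next
    case (step u v)
    then show ?case
      using assms(4) H.reachable_adj_trans by (auto simp flip: reachable_def)
  qed
qed

text \<open>The deleted parts of the copies are disjoint subsets of \<open>D\<close>, so their sizes
  sum to at most \<open>n\<close>. If each exceeded \<open>c * n\<close>, the sum would exceed
  \<open>num_copies c * c * n\<close>, which is at least \<open>n\<close>.\<close>

lemma ex_copy_few_deleted:
  fixes c :: real
  assumes "0 < c" and "finite D" and "card D \<le> n"
  obtains j where "j \<in> {1..num_copies c}" and "real (card {v. Copy j v \<in> D}) \<le> c * real n"
proof -
  let ?J = "{1..num_copies c}" and ?D = "\<lambda>j. {v. Copy j v \<in> D}"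
  have m: "1 \<le> c * real (num_copies c)"
  proof -
    have "1 / c \<le> real (num_copies c)"
      unfolding num_copies_def by (rule real_nat_ceiling_ge)
    then show ?thesis using assms(1) by (simp add: field_simps)
  qed
  have "(\<Sum>j\<in>?J. card (?D j)) = (\<Sum>j\<in>?J. card (Copy j ` ?D j))"
    by (intro sum.cong) (auto simp: card_image inj_on_def)
  also have "\<dots> = card (\<Union>j\<in>?J. Copy j ` ?D j)"
    by (rule card_UN_disjoint[symmetric]) (auto intro: finite_subset[OF _ assms(2)])
  also have "\<dots> \<le> card D"
    by (rule card_mono) (use assms(2) in auto)
  finally have le: "(\<Sum>j\<in>?J. card (?D j)) \<le> n" using assms(3) by simp
  have "\<exists>j\<in>?J. real (card (?D j)) \<le> c * real n"
  proof (rule ccontr)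
    assume "\<not> ?thesis"
    \<comment> \<open>Strictness of the summed inequality requires at least one copy.\<close>
    moreover have "?J \<noteq> {}" using m by (cases "num_copies c") auto
    ultimately have "(\<Sum>j\<in>?J. c * real n) < (\<Sum>j\<in>?J. real (card (?D j)))"
      by (intro sum_strict_mono) (auto simp: not_le)
    also have "\<dots> \<le> real n" using le by (simp flip: of_nat_sum)
    finally have "c * real (num_copies c) * real n < 1 * real n" by (simp add: algebra_simps)
    then show False using m mult_right_mono[OF m, of "real n"] by simp
  qed
  then show thesis using that by blast
qed

text \<open>This covers inputs and outputs alike: \<open>New\<close> is \<open>New_In\<close> or
  \<open>New_Out\<close>, \<open>f\<close> is \<open>inp\<close> or \<open>outp\<close>, and
  \<open>W\<close> is the vertex set of the subgraph of \<open>M\<close>. The deletions in copy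
  \<open>j\<close> and those among the new terminals are disjoint parts of \<open>D\<close>, so the
  two losses together are at most \<open>card D\<close>.\<close>

lemma card_surviving_terminals:
  assumes "finite D" and "inj New" and "inj_on f {1..n}"
    and "\<And>k v. New k \<noteq> Copy j v"
    and "n - card {v. Copy j v \<in> D} \<le> card (f ` {1..n} \<inter> W)"
  shows "n - card D \<le> card {k \<in> {1..n}. New k \<notin> D \<and> f k \<in> W}"
proof -
  let ?A = "{k \<in> {1..n}. f k \<in> W}" and ?B = "{k. New k \<in> D}" and ?C = "{v. Copy j v \<in> D}"
  have fin: "finite ?B" "finite ?C"
    using assms(1,2) finite_vimageI[of D New] finite_vimageI[of D "Copy j"]
    by (auto simp: vimage_def inj_on_def)
  have "card ?B + card ?C = card (New ` ?B) + card (Copy j ` ?C)"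
    using assms(2) by (simp add: card_image inj_on_def)
  also have "\<dots> = card (New ` ?B \<union> Copy j ` ?C)"
    using assms(4) fin by (subst card_Un_disjoint) auto
  also have "\<dots> \<le> card D" by (rule card_mono) (use assms(1) in auto)
  finally have BC: "card ?B + card ?C \<le> card D" .
  have "f ` {1..n} \<inter> W = f ` ?A" by auto
  moreover have "card (f ` ?A) = card ?A"
    by (rule card_image[OF inj_on_subset[OF assms(3)]]) auto
  ultimately have "n - card ?C \<le> card ?A" using assms(5) by simp
  moreover have "card ?A - card ?B \<le> card (?A - ?B)" using fin by (intro diff_card_le_card_Diff)
  moreover have "?A - ?B = {k \<in> {1..n}. New k \<notin> D \<and> f k \<in> W}" by auto
  ultimately show ?thesis using BC by simp
qed

theorem theorem5:
  fixes c :: real and M :: "'a pair_pre_digraph" and n :: nat and inp outp :: "nat \<Rightarrow> 'a"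
  assumes "0 < c" and "c \<le> 1"
    and "io_dag M n inp outp"
    and "c_maximally_ST_robust c M n inp outp"
  shows "maximally_ST_robust (O_graph c M n inp outp) n New_In New_Out"
proof -
  interpret M: io_dag M n inp outp by fact
  let ?G = "O_graph c M n inp outp"
  interpret G: io_dag ?G n New_In New_Out
    by (rule io_dag_O_graph) fact
  have "\<exists>H. subgraph H (with_proj ?G \<restriction> (pverts ?G - D)) \<and>
      n - k \<le> card (New_In ` {1..n} \<inter> verts H) \<and> n - k \<le> card (New_Out ` {1..n} \<inter> verts H) \<and>
      (\<forall>s \<in> New_In ` {1..n} \<inter> verts H. \<forall>t \<in> New_Out ` {1..n} \<inter> verts H.
        \<exists>p. pre_digraph.apath H s p t)"
    if k: "k \<le> n" and D: "D \<subseteq> pverts ?G" "card D \<le> k" for k D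
  proof -
    have finD: "finite D" using D(1) G.pair_finite_verts by (rule finite_subset)
    obtain j where j: "j \<in> {1..num_copies c}" and few: "real (card {v. Copy j v \<in> D}) \<le> c * real n"
      using ex_copy_few_deleted[OF assms(1) finD] D(2) k by (metis le_trans)
    define Dj where "Dj = {v. Copy j v \<in> D}"
    have "Dj \<subseteq> pverts M" using D(1) by (auto simp: Dj_def O_graph_def)
    \<comment> \<open>Robustness is used with the exact number of deletions in copy
      \<open>j\<close>, so that no more than \<open>card Dj\<close> terminals are lost
      there.\<close>
    moreover have "ST_robust M (inp ` {1..n}) (outp ` {1..n}) (card Dj) (n - card Dj)"
      using assms(4) few by (simp add: c_maximally_ST_robust_def Dj_def)
    ultimately obtain H where sub: "subgraph H (with_proj M \<restriction> (pverts M - Dj))"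
      and Hin: "n - card Dj \<le> card (inp ` {1..n} \<inter> verts H)"
      and Hout: "n - card Dj \<le> card (outp ` {1..n} \<inter> verts H)"
      and Hpath: "\<And>s t. s \<in> inp ` {1..n} \<inter> verts H \<Longrightarrow> t \<in> outp ` {1..n} \<inter> verts H \<Longrightarrow>
        \<exists>p. pre_digraph.apath H s p t"
      unfolding ST_robust_def by (metis order_refl)
    interpret H: wf_digraph H using sub by (auto simp: subgraph_def)
    have HV: "verts H \<subseteq> pverts M - Dj" using sub by (auto simp: subgraph_def)
    have Hadj: "(u, v) \<in> parcs M \<and> u \<in> verts H \<and> v \<in> verts H" if "u \<rightarrow>\<^bsub>H\<^esub> v" for u v
      using that sub H.adj_in_verts[OF that]
      by (fastforce simp: subgraph_def compatible_def arcs_ends_conv)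
    define A where "A = {i \<in> {1..n}. New_In i \<notin> D \<and> inp i \<in> verts H}"
    define B where "B = {i \<in> {1..n}. New_Out i \<notin> D \<and> outp i \<in> verts H}"
    define W where "W = New_In ` A \<union> New_Out ` B \<union> Copy j ` verts H"
    \<comment> \<open>Taking the induced subgraph makes every arc of \<open>O_graph\<close> between
      vertices of \<open>W\<close> available, including those joining new terminals to copy
      \<open>j\<close>.\<close>
    define H' where "H' = with_proj ?G \<restriction> W"
    have W: "W \<subseteq> pverts ?G - D"
      using HV j by (auto simp: W_def A_def B_def Dj_def O_graph_def)
    have sub': "subgraph H' (with_proj ?G \<restriction> (pverts ?G - D))"
      using W by (intro subgraphI) (auto simp: H'_def compatible_def)
    interpret H': wf_digraph H' using sub' by (auto simp: subgraph_def)
    have V': "verts H' = W" by (simp add: H'_def)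
    have adj': "u \<rightarrow>\<^bsub>H'\<^esub> v" if "(u, v) \<in> parcs ?G" "u \<in> W" "v \<in> W" for u v
      using that by (force simp: H'_def arcs_ends_conv)
    have ins: "New_In ` {1..n} \<inter> verts H' = New_In ` A"
      and outs: "New_Out ` {1..n} \<inter> verts H' = New_Out ` B"
      unfolding V' by (auto simp: W_def A_def B_def)
    have "n - k \<le> card A"
      using card_surviving_terminals[where New = New_In and f = inp,
          OF finD _ M.inj_inp _ Hin[unfolded Dj_def]] D(2)
      by (fastforce simp: A_def inj_def)
    moreover have "n - k \<le> card B"
      using card_surviving_terminals[where New = New_Out and f = outp,
          OF finD _ M.inj_outp _ Hout[unfolded Dj_def]] D(2)
      by (fastforce simp: B_def inj_def)
    moreover have "\<exists>p. H'.apath (New_In a) p (New_Out b)" if "a \<in> A" "b \<in> B" for a b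
    proof -
      have "\<exists>p. H.apath (inp a) p (outp b)"
        using that by (intro Hpath) (auto simp: A_def B_def)
      \<comment> \<open>Reachability replaces simple paths here, so that an arc can be added at
        either end without checking that vertices stay distinct.\<close>
      then have "inp a \<rightarrow>\<^sup>*\<^bsub>H\<^esub> outp b" by (simp add: H.reachable_apath)
      then have "Copy j (inp a) \<rightarrow>\<^sup>*\<^bsub>H'\<^esub> Copy j (outp b)"
        by (rule reachable_map)
          (use Hadj j in \<open>auto simp: V' W_def O_graph_def H'.wf_digraph_axioms intro!: adj'\<close>)
      moreover have "New_In a \<rightarrow>\<^bsub>H'\<^esub> Copy j (inp a)" "Copy j (outp b) \<rightarrow>\<^bsub>H'\<^esub> New_Out b"
        using that j by (auto simp: W_def O_graph_def A_def B_def intro!: adj')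
      ultimately show ?thesis
        by (meson H'.reachable_apath H'.adj_reachable_trans H'.reachable_adj_trans)
    qed
    ultimately show ?thesis
      by (intro exI[of _ H'] conjI sub', unfold ins outs) (auto simp: card_image inj_on_def)
  qed
  then show ?thesis unfolding maximally_ST_robust_def ST_robust_def
    by (intro allI impI)
qed

end
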